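(* Let $A^{C}\in\mathbb{R}^{M\times M}$ and $A^{G}\in\mathbb{R}^{N\times N}$ be symmetric matrices with eigenvalue decompositions $A^{C}=V^{C}\Lambda^{C}(V^{C})^\top$, $A^{G}=V^{G}\Lambda^{G}(V^{G})^\top$, where $V^{C},V^{G}$ are orthogonal with columns $v_i^{C}$ ($1\le i\le M$), $v_j^{G}$ ($1\le j\le N$), and $\Lambda^{C},\Lambda^{G}$ are diagonal with diagonal entries $\lambda_i^{C}$, $\lambda_j^{G}$ sorted in decreasing order. Let $h(\lambda^{C},\lambda^{G})=\sum_{i=0}^{T_G}\sum_{j=0}^{T_C}h_{ij}(\lambda^{C})^j(\lambda^{G})^i$ with $h_{ij}\in\mathbb{R}$ and $T_G,T_C\in\mathbb{Z}_+\cup\{\infty\}$ (convergent when an order is infinite), and let $\mathcal{H}(A^{C},A^{G})=\sum_{i=0}^{T_G}\sum_{j=0}^{T_C}h_{ij}(A^{C})^j\otimes(A^{G})^i$. Assume that the $NM$ numbers $|h(\lambda_j^{C},\lambda_i^{G})|$, $1\le i\le N$, $1\le j\le M$, are pairwise distinct. Let $y=\mathcal{H}(A^{C},A^{G})x$ (noiseless observations), where $x$ is a random vector in $\mathbb{R}^{NM}$ with $\mathbb{E}[x]=0$ and $\mathbb{E}[xx^\top]=I$. Then the product graph learning algorithm described in the context, run in the infinite-sample regime $S\to\infty$ (i.e. with the sample covariance replaced by its limit $C_y=\mathbb{E}[yy^\top]$), recovers the columns of $V^{C}$ and $V^{G}$: for every choice of orthonormal eigenvectors of $C_y$ in its first step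 and every choice of optimal solutions in its second step, the output $\widehat V^{C}$ is an $M\times M$ matrix whose columns are, up to permutation and sign changes, the columns $v_1^{C},\dots,v_M^{C}$ of $V^{C}$, and the output $\widehat V^{G}$ is an $N\times N$ matrix whose columns are, up to permutation and sign changes, the columns $v_1^{G},\dots,v_N^{G}$ of $V^{G}$.
   Context: $\otimes$ is the Kronecker product. $A^C$ and $A^G$ are the weighted adjacency matrices of two undirected graphs (the coupling graph with $M$ nodes and the physical graph with $N$ nodes). Rearrangement: for a vector $v\in\mathbb{R}^{NM}$ partitioned into $M$ consecutive blocks $v_{(1)},\dots,v_{(M)}\in\mathbb{R}^N$, $\mathcal{R}(v)\in\mathbb{R}^{M\times N}$ is the matrix whose $m$-th row is $v_{(m)}^\top$. Nearest Kronecker product decomposition (NKD) problem for $\mathcal{R}(v)$: minimize $\|\mathcal{R}(v)-\alpha\,a b^\top\|_F^2$ over $a\in\mathbb{R}^M$, $b\in\mathbb{R}^N$, $\alpha\in\mathbb{R}$ subject to $\|a\|=\|b\|=1$ (Euclidean norms). Algorithm (eigenvector recovery part). Input: the covariance matrix (for finitely many samples $y^{(1)},\dots,y^{(S)}$ this is $\frac1S\sum_{s=1}^S y^{(s)}(y^{(s)})^\top$; in the regime $S\to\infty$ it is $C_y=\mathbb{E}[yy^\top]$). 1. Compute an orthonormal basis $\widehat v_1,\dots,\widehat v_{NM}$ of eigenvectors of the input matrix. 2. For each $i=1,\dots,NM$, solve the NKD problem for $\mathcal{R}(\widehat v_i)$ and let $(\widehat v_i^{C},\widehat v_i^{G})\in\mathbb{R}^M\times\mathbb{R}^N$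 be the pair $(a,b)$ of an optimal solution. 3. Output $\widehat V^{C}=\mathrm{GS}([\widehat v_1^{C},\dots,\widehat v_{NM}^{C}])$ and $\widehat V^{G}=\mathrm{GS}([\widehat v_1^{G},\dots,\widehat v_{NM}^{G}])$, where $\mathrm{GS}$ is the Gram-Schmidt procedure: it processes the columns in order, subtracts from each its projection onto the span of the previously retained vectors, discards the column if the residual is zero, and otherwise normalizes the residual and retains it as the next output column. *)

theory Defs
  imports
    "HOL-Probability.Probability_Measure"
    "HOL-Library.Extended_Nat"
    "HOL-Combinatorics.Permutations"
    "Jordan_Normal_Form.Matrix"
    "Jordan_Normal_Form.Char_Poly"
begin

unbundle no vec_syntax
unbundle no inner_syntax

(* All indices are 0-based: a vector of R^n has components 0, ..., n - 1. *)

section \<open>Kronecker products and graph filters\<close>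

definition kronecker :: "real mat \<Rightarrow> real mat \<Rightarrow> real mat" where
  "kronecker A B = Matrix.mat (dim_row A * dim_row B) (dim_col A * dim_col B)
     (\<lambda>(p, q). A $$ (p div dim_row B, q div dim_col B) * B $$ (p mod dim_row B, q mod dim_col B))"

(* Sums over the indices 0, ..., T with T a natural number or \<infinity>. For finite T these are
   ordinary finite sums and converge trivially; for T = \<infinity> they are series in the sense of
   limits of partial sums, with no absolute convergence required. *)

definition summable_upto :: "enat \<Rightarrow> (nat \<Rightarrow> real) \<Rightarrow> bool" where
  "summable_upto T f \<longleftrightarrow> summable (\<lambda>k. if enat k \<le> T then f k else 0)"

definition sum_upto :: "enat \<Rightarrow> (nat \<Rightarrow> real) \<Rightarrow> real" where
  "sum_upto T f = (\<Sum>k. if enat k \<le> T then f k else 0)"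

definition mat_sum_upto :: "nat \<Rightarrow> enat \<Rightarrow> (nat \<Rightarrow> real mat) \<Rightarrow> real mat" where
  "mat_sum_upto n T F = Matrix.mat n n (\<lambda>(p, q). sum_upto T (\<lambda>k. F k $$ (p, q)))"

definition freq_response ::
    "(nat \<Rightarrow> nat \<Rightarrow> real) \<Rightarrow> enat \<Rightarrow> enat \<Rightarrow> real \<Rightarrow> real \<Rightarrow> real" where
  "freq_response h TG TC lc lg =
     sum_upto TG (\<lambda>i. sum_upto TC (\<lambda>j. h i j * lc ^ j * lg ^ i))"

definition freq_response_convergent ::
    "(nat \<Rightarrow> nat \<Rightarrow> real) \<Rightarrow> enat \<Rightarrow> enat \<Rightarrow> real \<Rightarrow> real \<Rightarrow> bool" where
  "freq_response_convergent h TG TC lc lg \<longleftrightarrow>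
     (\<forall>i. enat i \<le> TG \<longrightarrow> summable_upto TC (\<lambda>j. h i j * lc ^ j * lg ^ i)) \<and>
     summable_upto TG (\<lambda>i. sum_upto TC (\<lambda>j. h i j * lc ^ j * lg ^ i))"

definition graph_filter ::
    "(nat \<Rightarrow> nat \<Rightarrow> real) \<Rightarrow> enat \<Rightarrow> enat \<Rightarrow> real mat \<Rightarrow> real mat \<Rightarrow> real mat" where
  "graph_filter h TG TC AC AG =
     (let n = dim_row AC * dim_row AG in
      mat_sum_upto n TG (\<lambda>i. mat_sum_upto n TC (\<lambda>j.
        h i j \<cdot>\<^sub>m kronecker (AC ^\<^sub>m j) (AG ^\<^sub>m i))))"

section \<open>Random vectors\<close>

definition random_vector :: "'w measure \<Rightarrow> nat \<Rightarrow> ('w \<Rightarrow> real vec) \<Rightarrow> bool" where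
  "random_vector P n x \<longleftrightarrow>
     (\<forall>\<omega>\<in>space P. x \<omega> \<in> carrier_vec n) \<and>
     (\<forall>i<n. (\<lambda>\<omega>. x \<omega> $ i) \<in> borel_measurable P)"

definition square_integrable :: "'w measure \<Rightarrow> nat \<Rightarrow> ('w \<Rightarrow> real vec) \<Rightarrow> bool" where
  "square_integrable P n x \<longleftrightarrow> (\<forall>i<n. integrable P (\<lambda>\<omega>. (x \<omega> $ i)\<^sup>2))"

definition expectation_vec :: "'w measure \<Rightarrow> nat \<Rightarrow> ('w \<Rightarrow> real vec) \<Rightarrow> real vec" where
  "expectation_vec P n x = Matrix.vec n (\<lambda>i. \<integral>\<omega>. x \<omega> $ i \<partial>P)"

definition expectation_mat :: "'w measure \<Rightarrow> nat \<Rightarrow> ('w \<Rightarrow> real mat) \<Rightarrow> real mat" where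
  "expectation_mat P n X = Matrix.mat n n (\<lambda>(i, j). \<integral>\<omega>. X \<omega> $$ (i, j) \<partial>P)"

definition outer :: "real vec \<Rightarrow> real vec \<Rightarrow> real mat" where
  "outer u v = Matrix.mat (dim_vec u) (dim_vec v) (\<lambda>(i, j). u $ i * v $ j)"

section \<open>Nearest Kronecker product decomposition\<close>

definition vnorm :: "real vec \<Rightarrow> real" where
  "vnorm v = sqrt (v \<bullet> v)"

definition frobenius_norm :: "real mat \<Rightarrow> real" where
  "frobenius_norm A = sqrt (\<Sum>i<dim_row A. \<Sum>j<dim_col A. (A $$ (i, j))\<^sup>2)"

(* Row m of the result is the m-th of the M consecutive length-N blocks of v. *)
definition rearrange :: "nat \<Rightarrow> nat \<Rightarrow> real vec \<Rightarrow> real mat" where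
  "rearrange M N v = Matrix.mat M N (\<lambda>(m, n). v $ (m * N + n))"

definition nkd_feasible :: "nat \<Rightarrow> nat \<Rightarrow> real vec \<Rightarrow> real vec \<Rightarrow> bool" where
  "nkd_feasible M N a b \<longleftrightarrow>
     a \<in> carrier_vec M \<and> b \<in> carrier_vec N \<and> vnorm a = 1 \<and> vnorm b = 1"

definition nkd_objective :: "real mat \<Rightarrow> real \<Rightarrow> real vec \<Rightarrow> real vec \<Rightarrow> real" where
  "nkd_objective R \<alpha> a b = (frobenius_norm (R - \<alpha> \<cdot>\<^sub>m outer a b))\<^sup>2"

definition nkd_optimal :: "nat \<Rightarrow> nat \<Rightarrow> real mat \<Rightarrow> real \<Rightarrow> real vec \<Rightarrow> real vec \<Rightarrow> bool" where
  "nkd_optimal M N R \<alpha> a b \<longleftrightarrow>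
     nkd_feasible M N a b \<and>
     (\<forall>\<alpha>' a' b'. nkd_feasible M N a' b' \<longrightarrow> nkd_objective R \<alpha> a b \<le> nkd_objective R \<alpha>' a' b')"

section \<open>The Gram-Schmidt procedure\<close>

(* The retained vectors qs are orthonormal, so the projection of v onto their span is the
   sum of the vectors (q \<bullet> v) q over q in qs. *)
definition gs_residual :: "real vec list \<Rightarrow> real vec \<Rightarrow> real vec" where
  "gs_residual qs v = fold (\<lambda>q r. r - (q \<bullet> v) \<cdot>\<^sub>v q) qs v"

fun gs_aux :: "real vec list \<Rightarrow> real vec list \<Rightarrow> real vec list" where
  "gs_aux qs [] = qs"
| "gs_aux qs (v # vs) =
     (let r = gs_residual qs v in
      if r = 0\<^sub>v (dim_vec v) then gs_aux qs vs
      else gs_aux (qs @ [(1 / vnorm r) \<cdot>\<^sub>v r]) vs)"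

definition gram_schmidt_columns :: "real vec list \<Rightarrow> real vec list" where
  "gram_schmidt_columns vs = gs_aux [] vs"

section \<open>Eigenvector recovery\<close>

(* n orthonormal vectors in R^n automatically form a basis. *)
definition orthonormal_eigenbasis :: "nat \<Rightarrow> real mat \<Rightarrow> real vec list \<Rightarrow> bool" where
  "orthonormal_eigenbasis n C vs \<longleftrightarrow>
     length vs = n \<and>
     (\<forall>i<n. vs ! i \<in> carrier_vec n \<and> (\<exists>e. eigenvector C (vs ! i) e)) \<and>
     (\<forall>i<n. \<forall>j<n. vs ! i \<bullet> vs ! j = (if i = j then 1 else 0))"

(* (VC, VG) is a possible output of the algorithm on input C: steps 1 and 2 involve choices,
   hence a relation. *)
definition eigenvector_recovery ::
    "nat \<Rightarrow> nat \<Rightarrow> real mat \<Rightarrow> real mat \<Rightarrow> real mat \<Rightarrow> bool" where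
  "eigenvector_recovery M N C VC VG \<longleftrightarrow>
     (\<exists>vs cs gs.
        orthonormal_eigenbasis (M * N) C vs \<and>
        length cs = M * N \<and> length gs = M * N \<and>
        (\<forall>i<M * N. \<exists>\<alpha>. nkd_optimal M N (rearrange M N (vs ! i)) \<alpha> (cs ! i) (gs ! i)) \<and>
        VC = mat_of_cols M (gram_schmidt_columns cs) \<and>
        VG = mat_of_cols N (gram_schmidt_columns gs))"

definition same_cols_upto_perm_sign :: "nat \<Rightarrow> real mat \<Rightarrow> real mat \<Rightarrow> bool" where
  "same_cols_upto_perm_sign n W V \<longleftrightarrow>
     W \<in> carrier_mat n n \<and>
     (\<exists>\<pi> s. \<pi> permutes {..<n} \<and>
        (\<forall>i<n. s i \<in> {1, -1} \<and> col W i = s i \<cdot>\<^sub>v col V (\<pi> i)))"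

end

theory Submission
  imports Defs
begin

text \<open>
  In the basis of Kronecker products \<open>u\<^bsub>ab\<^esub> = v\<^sup>C\<^sub>a \<otimes> v\<^sup>G\<^sub>b\<close> the filter is diagonal with entries
  \<open>h (\<lambda>\<^sup>C\<^sub>a, \<lambda>\<^sup>G\<^sub>b)\<close>, so the covariance \<open>H H\<^sup>T\<close> of the output has the pairwise distinct eigenvalues
  \<open>h (\<lambda>\<^sup>C\<^sub>a, \<lambda>\<^sup>G\<^sub>b)\<^sup>2\<close>. Hence every orthonormal eigenbasis consists of the \<open>u\<^bsub>ab\<^esub>\<close> up to order and
  signs. The rearrangement of \<open>u\<^bsub>ab\<^esub>\<close> has rank one, so the nearest Kronecker product has error zero
  and its unit factors are \<open>v\<^sup>C\<^sub>a\<close> and \<open>v\<^sup>G\<^sub>b\<close> up to sign. Each \<open>v\<^sup>C\<^sub>a\<close> and each \<open>v\<^sup>G\<^sub>b\<close> thus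
  occurs in the input of the Gram-Schmidt procedure, which keeps the first signed copy of each and
  discards the later ones.
\<close>

section \<open>Block indices and orthogonal matrices\<close>

lemma block_index_less:
  assumes "(m::nat) < M" "n < N"
  shows "m * N + n < M * N"
proof -
  have "m * N + n < Suc m * N" using assms by simp
  also have "\<dots> \<le> M * N" using assms by (intro mult_le_mono1) simp
  finally show ?thesis .
qed

text \<open>Quotient and remainder by \<open>N\<close> split a flat index into block number and
  position. This lets inner products of Kronecker vectors factor into inner products of the two
  parts.\<close>

lemma sum_div_mod_Times:
  fixes f :: "nat \<Rightarrow> nat \<Rightarrow> 'a::comm_monoid_add"
  shows "(\<Sum>p<M * N. f (p div N) (p mod N)) = (\<Sum>(m, n)\<in>{..<M} \<times> {..<N}. f m n)"
proof (cases "N = 0")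
  case False
  then show ?thesis
    by (intro sum.reindex_bij_witness[where i = "\<lambda>(m, n). m * N + n" and j = "\<lambda>p. (p div N, p mod N)"])
      (auto simp: less_mult_imp_div_less intro: block_index_less)
qed auto

lemma scalar_prod_lessThan:
  "v \<in> carrier_vec n \<Longrightarrow> w \<in> carrier_vec n \<Longrightarrow> v \<bullet> w = (\<Sum>i<n. v $ i * w $ i)"
  by (simp add: scalar_prod_def atLeast0LessThan)

text \<open>The column relation is \<open>V\<^sup>T * V = 1\<^sub>m n\<close> read entrywise. The
  row relation follows because a left inverse of a square matrix is also a right inverse. Columns
  later yield orthonormality of the Kronecker basis, rows its completeness.\<close>

lemma orthonormal_matrix_index:
  fixes V :: "'a::field mat"
  assumes V: "V \<in> carrier_mat n n" and VV: "V\<^sup>T * V = 1\<^sub>m n" and "a < n" "b < n"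
  shows "(\<Sum>p<n. V $$ (p, a) * V $$ (p, b)) = (if a = b then 1 else 0)"
    and "(\<Sum>p<n. V $$ (a, p) * V $$ (b, p)) = (if a = b then 1 else 0)"
proof -
  have "(\<Sum>p<n. V $$ (p, a) * V $$ (p, b)) = (V\<^sup>T * V) $$ (a, b)"
    using V \<open>a < n\<close> \<open>b < n\<close> by (simp add: scalar_prod_def atLeast0LessThan)
  also have "\<dots> = (if a = b then 1 else 0)"
    unfolding VV using \<open>a < n\<close> \<open>b < n\<close> by simp
  finally show "(\<Sum>p<n. V $$ (p, a) * V $$ (p, b)) = (if a = b then 1 else 0)" .
  have VV': "V * V\<^sup>T = 1\<^sub>m n"
    using mat_mult_left_right_inverse[of "V\<^sup>T" n V] V VV by simp
  have "(\<Sum>p<n. V $$ (a, p) * V $$ (b, p)) = (V * V\<^sup>T) $$ (a, b)"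
    using V \<open>a < n\<close> \<open>b < n\<close> by (simp add: scalar_prod_def atLeast0LessThan)
  also have "\<dots> = (if a = b then 1 else 0)"
    unfolding VV' using \<open>a < n\<close> \<open>b < n\<close> by simp
  finally show "(\<Sum>p<n. V $$ (a, p) * V $$ (b, p)) = (if a = b then 1 else 0)" .
qed

text \<open>Each further factor \<open>A\<close> introduces an inner index \<open>r\<close>, and
  summing over it leaves only the terms \<open>a = b\<close> by column orthonormality. The index
  \<open>q\<close> must vary in the induction, since the hypothesis is applied at column
  \<open>r\<close>. The case \<open>k = 0\<close> is row orthonormality.\<close>

lemma diagonalized_pow_index:
  fixes V :: "'a::field mat"
  assumes V: "V \<in> carrier_mat n n" and VV: "V\<^sup>T * V = 1\<^sub>m n"
    and A: "A = V * mat_diag n l * V\<^sup>T" and "p < n" "q < n"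
  shows "(A ^\<^sub>m k) $$ (p, q) = (\<Sum>a<n. V $$ (p, a) * V $$ (q, a) * l a ^ k)"
  using \<open>q < n\<close>
proof (induction k arbitrary: q)
  case 0
  have "dim_row A = n" using V A by simp
  then show ?case
    using 0 orthonormal_matrix_index(2)[OF V VV \<open>p < n\<close> 0] \<open>p < n\<close> by simp
next
  case (Suc k)
  have Ac: "A \<in> carrier_mat n n"
    unfolding A using V by (intro mult_carrier_mat mat_diag_dim) auto
  have Ai: "A $$ (r, q) = (\<Sum>b<n. V $$ (r, b) * l b * V $$ (q, b))" if "r < n" for r
    using that Suc.prems V
    by (simp add: A mat_diag_mult_right[OF V] scalar_prod_def atLeast0LessThan)
  have "(A ^\<^sub>m Suc k) $$ (p, q) = (\<Sum>r<n. (A ^\<^sub>m k) $$ (p, r) * A $$ (r, q))"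
    using Suc.prems \<open>p < n\<close> Ac pow_carrier_mat[OF Ac, of k]
    by (simp add: scalar_prod_def atLeast0LessThan)
  also have "\<dots> = (\<Sum>r<n. \<Sum>a<n. \<Sum>b<n. V $$ (p, a) * l a ^ k * l b * V $$ (q, b) * (V $$ (r, a) * V $$ (r, b)))"
  proof (intro sum.cong refl)
    fix r assume "r \<in> {..<n}"
    then have r: "r < n" by simp
    show "(A ^\<^sub>m k) $$ (p, r) * A $$ (r, q) =
      (\<Sum>a<n. \<Sum>b<n. V $$ (p, a) * l a ^ k * l b * V $$ (q, b) * (V $$ (r, a) * V $$ (r, b)))"
      unfolding Suc.IH[OF r] Ai[OF r] sum_product by (simp add: ac_simps)
  qed
  also have "\<dots> = (\<Sum>a<n. \<Sum>b<n. \<Sum>r<n. V $$ (p, a) * l a ^ k * l b * V $$ (q, b) * (V $$ (r, a) * V $$ (r, b)))"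
    by (subst sum.swap, rule sum.cong[OF refl], rule sum.swap)
  also have "\<dots> = (\<Sum>a<n. \<Sum>b<n. if a = b then V $$ (p, a) * l a ^ k * l b * V $$ (q, b) else 0)"
    by (intro sum.cong refl) (simp add: sum_distrib_left[symmetric] orthonormal_matrix_index(1)[OF V VV])
  also have "\<dots> = (\<Sum>a<n. V $$ (p, a) * V $$ (q, a) * l a ^ Suc k)"
    by (simp add: ac_simps)
  finally show ?case .
qed

section \<open>Spectral form of the graph filter\<close>

lemma sum_upto_sum:
  assumes "\<And>t. t \<in> S \<Longrightarrow> summable_upto T (f t)"
  shows "sum_upto T (\<lambda>k. \<Sum>t\<in>S. c t * f t k) = (\<Sum>t\<in>S. c t * sum_upto T (f t))"
proof -
  have "(\<lambda>k. if enat k \<le> T then \<Sum>t\<in>S. c t * f t k else 0)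
      = (\<lambda>k. \<Sum>t\<in>S. c t * (if enat k \<le> T then f t k else 0))"
    by auto
  moreover have "summable (\<lambda>k. if enat k \<le> T then f t k else 0)" if "t \<in> S" for t
    using assms[OF that] unfolding summable_upto_def .
  ultimately show ?thesis
    unfolding sum_upto_def by (simp add: suminf_sum summable_mult suminf_mult)
qed

lemma sum_upto_cong:
  "(\<And>k. enat k \<le> T \<Longrightarrow> f k = g k) \<Longrightarrow> sum_upto T f = sum_upto T g"
  unfolding sum_upto_def by (rule arg_cong[where f = suminf]) auto

text \<open>Every Kronecker product of powers is diagonal in the same basis, so the series over the
  orders can be summed separately for each eigenvalue pair, which gives the frequency response
  there.\<close>

lemma graph_filter_index:
  assumes VC: "VC \<in> carrier_mat M M" "VC\<^sup>T * VC = 1\<^sub>m M"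
    and VG: "VG \<in> carrier_mat N N" "VG\<^sup>T * VG = 1\<^sub>m N"
    and AC: "AC = VC * mat_diag M lC * VC\<^sup>T" and AG: "AG = VG * mat_diag N lG * VG\<^sup>T"
    and conv: "\<And>j i. j < M \<Longrightarrow> i < N \<Longrightarrow> freq_response_convergent h TG TC (lC j) (lG i)"
    and p: "p < M * N" and q: "q < M * N"
  shows "graph_filter h TG TC AC AG $$ (p, q) =
    (\<Sum>(a, b)\<in>{..<M} \<times> {..<N}. freq_response h TG TC (lC a) (lG b) *
       (VC $$ (p div N, a) * VG $$ (p mod N, b)) * (VC $$ (q div N, a) * VG $$ (q mod N, b)))"
proof -
  \<comment> \<open>The eigenvector entries \<open>c\<close> do not depend on the orders
    \<open>i\<close> and \<open>j\<close>; separated from the scalar terms \<open>F\<close>, they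
    can be pulled out of both series.\<close>
  define c where "c t = VC $$ (p div N, fst t) * VG $$ (p mod N, snd t) *
    (VC $$ (q div N, fst t) * VG $$ (q mod N, snd t))" for t
  define F where "F t i j = h i j * lC (fst t) ^ j * lG (snd t) ^ i" for t i j
  let ?S = "{..<M} \<times> {..<N}"
  have N: "N > 0" using p by (cases N) auto
  have less: "p div N < M" "q div N < M" "p mod N < N" "q mod N < N"
    using p q N by (auto simp: less_mult_imp_div_less)
  have carr: "AC \<in> carrier_mat M M" "AG \<in> carrier_mat N N"
    unfolding AC AG using VC VG by (auto intro!: mult_carrier_mat mat_diag_dim)
  have entry: "(h i j \<cdot>\<^sub>m kronecker (AC ^\<^sub>m j) (AG ^\<^sub>m i)) $$ (p, q) = (\<Sum>t\<in>?S. c t * F t i j)" for i j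
  proof -
    have "dim_row (AC ^\<^sub>m j) = M" "dim_col (AC ^\<^sub>m j) = M" "dim_row (AG ^\<^sub>m i) = N" "dim_col (AG ^\<^sub>m i) = N"
      using carrier_matD[OF pow_carrier_mat[OF carr(1)]] carrier_matD[OF pow_carrier_mat[OF carr(2)]] by auto
    then have "(h i j \<cdot>\<^sub>m kronecker (AC ^\<^sub>m j) (AG ^\<^sub>m i)) $$ (p, q) =
        h i j * ((AC ^\<^sub>m j) $$ (p div N, q div N) * (AG ^\<^sub>m i) $$ (p mod N, q mod N))"
      using p q by (simp add: kronecker_def)
    also have "\<dots> = (\<Sum>t\<in>?S. c t * F t i j)"
      unfolding diagonalized_pow_index[OF VC AC less(1,2)] diagonalized_pow_index[OF VG AG less(3,4)]
        sum_product sum.cartesian_product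
      unfolding sum_distrib_left
      by (intro sum.cong refl) (auto simp: c_def F_def)
    finally show ?thesis .
  qed
  have summ: "enat i \<le> TG \<Longrightarrow> summable_upto TC (F t i)" "summable_upto TG (\<lambda>i. sum_upto TC (F t i))"
    if "t \<in> ?S" for t i
    using conv[of "fst t" "snd t"] that unfolding freq_response_convergent_def F_def by auto
  have "graph_filter h TG TC AC AG $$ (p, q) =
      sum_upto TG (\<lambda>i. sum_upto TC (\<lambda>j. (h i j \<cdot>\<^sub>m kronecker (AC ^\<^sub>m j) (AG ^\<^sub>m i)) $$ (p, q)))"
    using p q carr by (simp add: graph_filter_def mat_sum_upto_def Let_def)
  \<comment> \<open>Convergence of the inner series is assumed only for orders \<open>i\<close> up
    to \<open>TG\<close>; \<open>sum_upto_cong\<close> restricts the exchange to these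
    orders.\<close>
  also have "\<dots> = sum_upto TG (\<lambda>i. \<Sum>t\<in>?S. c t * sum_upto TC (F t i))"
    unfolding entry by (intro sum_upto_cong sum_upto_sum summ)
  also have "\<dots> = (\<Sum>t\<in>?S. c t * sum_upto TG (\<lambda>i. sum_upto TC (F t i)))"
    by (intro sum_upto_sum summ)
  also have "\<dots> = (\<Sum>(a, b)\<in>?S. freq_response h TG TC (lC a) (lG b) *
       (VC $$ (p div N, a) * VG $$ (p mod N, b)) * (VC $$ (q div N, a) * VG $$ (q mod N, b)))"
    by (intro sum.cong refl) (auto simp: c_def F_def[abs_def] freq_response_def)
  finally show ?thesis .
qed

section \<open>Covariance of the output and its eigenvectors\<close>

text \<open>Linearity of expectation moves \<open>H\<close> out on both sides, leaving the second
  moments of \<open>x\<close>, which form the identity.\<close>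

lemma covariance_of_white_input:
  assumes x: "random_vector P n x" and sq: "square_integrable P n x"
    and white: "expectation_mat P n (\<lambda>\<omega>. outer (x \<omega>) (x \<omega>)) = 1\<^sub>m n"
    and H: "H \<in> carrier_mat n n"
    and y: "\<And>\<omega>. \<omega> \<in> space P \<Longrightarrow> y \<omega> = H *\<^sub>v x \<omega>"
  shows "expectation_mat P n (\<lambda>\<omega>. outer (y \<omega>) (y \<omega>)) = H * H\<^sup>T"
proof (rule eq_matI)
  have xc: "x \<omega> \<in> carrier_vec n" if "\<omega> \<in> space P" for \<omega>
    using x that unfolding random_vector_def by auto
  \<comment> \<open>Exchanging the expectation with the double sum below needs integrable products
    of coordinates; each is dominated by the sum of the two squares.\<close>
  have int: "integrable P (\<lambda>\<omega>. x \<omega> $ k * x \<omega> $ l)" if "k < n" "l < n" for k l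
  proof (rule Bochner_Integration.integrable_bound)
    show "integrable P (\<lambda>\<omega>. (x \<omega> $ k)\<^sup>2 + (x \<omega> $ l)\<^sup>2)"
      using sq that unfolding square_integrable_def by auto
    show "(\<lambda>\<omega>. x \<omega> $ k * x \<omega> $ l) \<in> borel_measurable P"
      using x that unfolding random_vector_def by (intro borel_measurable_times) auto
    have "\<bar>a * b\<bar> \<le> a\<^sup>2 + b\<^sup>2" for a b :: real
      using sum_squares_bound[of "\<bar>a\<bar>" "\<bar>b\<bar>"] abs_ge_zero[of "a * b"]
      unfolding power2_abs abs_mult by linarith
    then show "AE \<omega> in P. norm (x \<omega> $ k * x \<omega> $ l) \<le> norm ((x \<omega> $ k)\<^sup>2 + (x \<omega> $ l)\<^sup>2)"
      by simp
  qed
  have E: "(\<integral>\<omega>. x \<omega> $ k * x \<omega> $ l \<partial>P) = (if k = l then 1 else 0)" if "k < n" "l < n" for k l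
  proof -
    have "(\<integral>\<omega>. x \<omega> $ k * x \<omega> $ l \<partial>P) = (\<integral>\<omega>. outer (x \<omega>) (x \<omega>) $$ (k, l) \<partial>P)"
      by (intro Bochner_Integration.integral_cong refl) (simp add: outer_def carrier_vecD[OF xc] that)
    also have "\<dots> = expectation_mat P n (\<lambda>\<omega>. outer (x \<omega>) (x \<omega>)) $$ (k, l)"
      using that by (simp add: expectation_mat_def)
    finally show ?thesis using that white by simp
  qed
  fix i j assume "i < dim_row (H * H\<^sup>T)" "j < dim_col (H * H\<^sup>T)"
  then have ij: "i < n" "j < n" using H by auto
  have "expectation_mat P n (\<lambda>\<omega>. outer (y \<omega>) (y \<omega>)) $$ (i, j) = (\<integral>\<omega>. outer (y \<omega>) (y \<omega>) $$ (i, j) \<partial>P)"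
    using ij by (simp add: expectation_mat_def)
  also have "\<dots> = (\<integral>\<omega>. (\<Sum>k<n. \<Sum>l<n. H $$ (i, k) * H $$ (j, l) * (x \<omega> $ k * x \<omega> $ l)) \<partial>P)"
  proof (intro Bochner_Integration.integral_cong refl)
    fix \<omega> assume w: "\<omega> \<in> space P"
    have "(H *\<^sub>v x \<omega>) $ r = (\<Sum>k<n. H $$ (r, k) * x \<omega> $ k)" if "r < n" for r
      using that H xc[OF w] by (simp add: scalar_prod_def atLeast0LessThan)
    then show "outer (y \<omega>) (y \<omega>) $$ (i, j) = (\<Sum>k<n. \<Sum>l<n. H $$ (i, k) * H $$ (j, l) * (x \<omega> $ k * x \<omega> $ l))"
      using ij H y[OF w] by (simp add: outer_def sum_product ac_simps)
  qed
  also have "\<dots> = (\<Sum>k<n. \<Sum>l<n. H $$ (i, k) * H $$ (j, l) * (\<integral>\<omega>. x \<omega> $ k * x \<omega> $ l \<partial>P))"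
  proof -
    have I: "integrable P (\<lambda>\<omega>. H $$ (i, k) * H $$ (j, l) * (x \<omega> $ k * x \<omega> $ l))"
      if "k < n" "l < n" for k l
      using int[OF that] by simp
    have "(\<integral>\<omega>. (\<Sum>k<n. \<Sum>l<n. H $$ (i, k) * H $$ (j, l) * (x \<omega> $ k * x \<omega> $ l)) \<partial>P)
        = (\<Sum>k<n. \<integral>\<omega>. (\<Sum>l<n. H $$ (i, k) * H $$ (j, l) * (x \<omega> $ k * x \<omega> $ l)) \<partial>P)"
      by (intro Bochner_Integration.integral_sum Bochner_Integration.integrable_sum I) auto
    also have "\<dots> = (\<Sum>k<n. \<Sum>l<n. \<integral>\<omega>. H $$ (i, k) * H $$ (j, l) * (x \<omega> $ k * x \<omega> $ l) \<partial>P)"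
      by (rule sum.cong[OF refl], rule Bochner_Integration.integral_sum) (rule I; simp)
    finally show ?thesis by simp
  qed
  also have "\<dots> = (\<Sum>k<n. \<Sum>l<n. if k = l then H $$ (i, k) * H $$ (j, l) else 0)"
    by (intro sum.cong refl) (simp add: E)
  also have "\<dots> = (H * H\<^sup>T) $$ (i, j)"
    using ij H by (simp add: scalar_prod_def atLeast0LessThan)
  finally show "expectation_mat P n (\<lambda>\<omega>. outer (y \<omega>) (y \<omega>)) $$ (i, j) = (H * H\<^sup>T) $$ (i, j)" .
qed (use H in \<open>auto simp: expectation_mat_def\<close>)

text \<open>Orthonormality removes the mixed terms of the product and squares the weights. This is
  why the absolute values of the frequency response are what must be distinct.\<close>

lemma spectral_square:
  fixes U :: "'t \<Rightarrow> nat \<Rightarrow> real"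
  assumes "finite S" and H: "H \<in> carrier_mat n n"
    and spec: "\<And>p q. p < n \<Longrightarrow> q < n \<Longrightarrow> H $$ (p, q) = (\<Sum>t\<in>S. f t * U t p * U t q)"
    and orth: "\<And>s t. s \<in> S \<Longrightarrow> t \<in> S \<Longrightarrow> (\<Sum>p<n. U s p * U t p) = (if s = t then 1 else 0)"
    and pq: "p < n" "q < n"
  shows "(H * H\<^sup>T) $$ (p, q) = (\<Sum>t\<in>S. (f t)\<^sup>2 * U t p * U t q)"
proof -
  have "(H * H\<^sup>T) $$ (p, q) = (\<Sum>r<n. H $$ (p, r) * H $$ (q, r))"
    using pq H by (simp add: scalar_prod_def atLeast0LessThan)
  also have "\<dots> = (\<Sum>r<n. \<Sum>s\<in>S. \<Sum>t\<in>S. f s * U s p * f t * U t q * (U s r * U t r))"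
    by (intro sum.cong refl) (simp add: pq spec sum_product ac_simps)
  also have "\<dots> = (\<Sum>s\<in>S. \<Sum>t\<in>S. \<Sum>r<n. f s * U s p * f t * U t q * (U s r * U t r))"
    by (subst sum.swap, rule sum.cong[OF refl], rule sum.swap)
  also have "\<dots> = (\<Sum>s\<in>S. \<Sum>t\<in>S. if s = t then f s * U s p * f t * U t q else 0)"
    by (intro sum.cong refl) (simp add: sum_distrib_left[symmetric] orth)
  also have "\<dots> = (\<Sum>t\<in>S. (f t)\<^sup>2 * U t p * U t q)"
    using \<open>finite S\<close> by (simp add: power2_eq_square ac_simps)
  finally show ?thesis .
qed

text \<open>Expanded in the basis \<open>U\<close>, the eigenvalue equation becomes one scalar
  equation per coefficient. Distinct eigenvalues allow only one nonzero coefficient, and unit length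
  makes it a sign.\<close>

lemma unit_eigenvector_simple_spectrum:
  fixes U :: "'t \<Rightarrow> nat \<Rightarrow> real"
  assumes S: "finite S" and C: "C \<in> carrier_mat n n"
    and spec: "\<And>p q. p < n \<Longrightarrow> q < n \<Longrightarrow> C $$ (p, q) = (\<Sum>t\<in>S. g t * U t p * U t q)"
    and inj: "inj_on g S"
    and orth: "\<And>s t. s \<in> S \<Longrightarrow> t \<in> S \<Longrightarrow> (\<Sum>p<n. U s p * U t p) = (if s = t then 1 else 0)"
    and compl: "\<And>p q. p < n \<Longrightarrow> q < n \<Longrightarrow> (\<Sum>t\<in>S. U t p * U t q) = (if p = q then 1 else 0)"
    and ev: "eigenvector C v e" and unit: "v \<bullet> v = 1"
  obtains t s where "t \<in> S" "s \<in> {1, -1}" "\<And>p. p < n \<Longrightarrow> v $ p = s * U t p"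
proof -
  have v: "v \<in> carrier_vec n" and Cv: "C *\<^sub>v v = e \<cdot>\<^sub>v v"
    using ev C unfolding eigenvector_def by auto
  define c where "c t = (\<Sum>q<n. U t q * v $ q)" for t
  have exp: "v $ p = (\<Sum>t\<in>S. c t * U t p)" if "p < n" for p
  proof -
    have "(\<Sum>t\<in>S. c t * U t p) = (\<Sum>q<n. \<Sum>t\<in>S. v $ q * (U t p * U t q))"
      unfolding c_def sum_distrib_right by (subst sum.swap) (simp add: ac_simps)
    also have "\<dots> = (\<Sum>q<n. if p = q then v $ q else 0)"
      by (intro sum.cong refl) (simp add: sum_distrib_left[symmetric] compl that)
    finally show ?thesis using that by simp
  qed
  \<comment> \<open>Inner product of the eigenvalue equation with \<open>U t\<close>.\<close>
  have eig: "e * c t = g t * c t" if t: "t \<in> S" for t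
  proof -
    have Cvp: "e * v $ p = (\<Sum>s\<in>S. g s * c s * U s p)" if p: "p < n" for p
    proof -
      have "e * v $ p = (C *\<^sub>v v) $ p" using Cv v p by simp
      also have "\<dots> = (\<Sum>q<n. C $$ (p, q) * v $ q)"
        using C v p by (simp add: scalar_prod_def atLeast0LessThan)
      also have "\<dots> = (\<Sum>q<n. \<Sum>s\<in>S. g s * U s p * U s q * v $ q)"
        by (intro sum.cong refl) (simp add: spec p sum_distrib_right)
      also have "\<dots> = (\<Sum>s\<in>S. g s * c s * U s p)"
        unfolding c_def sum_distrib_left sum_distrib_right by (subst sum.swap) (simp add: ac_simps)
      finally show ?thesis .
    qed
    have "e * c t = (\<Sum>p<n. U t p * (e * v $ p))"
      unfolding c_def sum_distrib_left by (simp add: ac_simps)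
    also have "\<dots> = (\<Sum>p<n. \<Sum>s\<in>S. g s * c s * (U t p * U s p))"
      by (intro sum.cong refl) (simp add: Cvp sum_distrib_left ac_simps)
    also have "\<dots> = (\<Sum>s\<in>S. \<Sum>p<n. g s * c s * (U t p * U s p))"
      by (rule sum.swap)
    also have "\<dots> = (\<Sum>s\<in>S. if t = s then g s * c s else 0)"
      by (intro sum.cong refl) (simp add: sum_distrib_left[symmetric] orth t)
    finally show ?thesis using S t by simp
  qed
  have "\<exists>t\<in>S. c t \<noteq> 0"
  proof (rule ccontr)
    assume "\<not> ?thesis"
    then have "v $ p = 0" if "p < n" for p using exp[OF that] by simp
    then show False using unit v by (simp add: scalar_prod_lessThan)
  qed
  then obtain t where t: "t \<in> S" "c t \<noteq> 0" by auto
  \<comment> \<open>A second nonzero coefficient would give \<open>g s = e = g t\<close>, against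
    injectivity.\<close>
  have "c s = 0" if "s \<in> S" "s \<noteq> t" for s
    using eig[OF t(1)] eig[OF that(1)] t that inj_onD[OF inj _ that(1) t(1)] by auto
  then have vt: "v $ p = c t * U t p" if "p < n" for p
    unfolding exp[OF that] using S t(1) by (subst sum.remove[of _ t]) auto
  have "1 = (\<Sum>p<n. (c t)\<^sup>2 * (U t p * U t p))"
    using unit v by (simp add: scalar_prod_lessThan vt power2_eq_square ac_simps)
  also have "\<dots> = (c t)\<^sup>2" using orth[OF t(1) t(1)] by (simp add: sum_distrib_left[symmetric])
  finally have "c t \<in> {1, -1}" by (auto simp: power2_eq_1_iff)
  then show thesis using that t vt by blast
qed

section \<open>Nearest Kronecker product of a rank-one matrix\<close>

lemma frobenius_norm_eq_0_iff:
  "frobenius_norm A = 0 \<longleftrightarrow> A = 0\<^sub>m (dim_row A) (dim_col A)"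
proof
  assume "frobenius_norm A = 0"
  then have "(\<Sum>i<dim_row A. \<Sum>j<dim_col A. (A $$ (i, j))\<^sup>2) = 0"
    unfolding frobenius_norm_def by simp
  then have "\<forall>i<dim_row A. \<forall>j<dim_col A. A $$ (i, j) = 0"
    by (simp add: sum_nonneg_eq_0_iff sum_nonneg)
  then show "A = 0\<^sub>m (dim_row A) (dim_col A)" by (intro eq_matI) auto
next
  assume "A = 0\<^sub>m (dim_row A) (dim_col A)"
  then have "\<forall>i<dim_row A. \<forall>j<dim_col A. A $$ (i, j) = 0"
    by (metis index_zero_mat(1))
  then show "frobenius_norm A = 0" unfolding frobenius_norm_def by simp
qed

lemma vnorm_eq_1_iff: "vnorm v = 1 \<longleftrightarrow> v \<bullet> v = 1"
  unfolding vnorm_def by simp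

text \<open>Contracting both rank-one matrices with the unit vector \<open>b\<close> shows that
  \<open>a\<close> is a multiple of \<open>a'\<close>; as both have unit length, the multiple is a
  sign. Only the first factor is treated, the second being the same statement for the
  transposes.\<close>

lemma outer_eq_outer_unit:
  fixes a b a' b' :: "real vec"
  assumes a: "a \<in> carrier_vec M" "a \<bullet> a = 1" and b: "b \<in> carrier_vec N" "b \<bullet> b = 1"
    and a': "a' \<in> carrier_vec M" "a' \<bullet> a' = 1" and b': "b' \<in> carrier_vec N"
    and s: "s \<noteq> 0"
    and eq: "\<And>m n. m < M \<Longrightarrow> n < N \<Longrightarrow> s * (a $ m * b $ n) = \<alpha> * (a' $ m * b' $ n)"
  obtains r :: real where "r \<in> {1, -1}" "a' = r \<cdot>\<^sub>v a"
proof -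
  \<comment> \<open>The factor read off from the contraction
    \<open>s * a $ m = a' $ m * \<alpha> * (b' \<bullet> b)\<close>.\<close>
  define k where "k = \<alpha> * (b' \<bullet> b) / s"
  have "a $ m = k * a' $ m" if m: "m < M" for m
  proof -
    have "s * a $ m = (\<Sum>n<N. s * (a $ m * b $ n) * b $ n)"
      using b by (simp add: scalar_prod_lessThan sum_distrib_left[symmetric] ac_simps)
    also have "\<dots> = (\<Sum>n<N. a' $ m * \<alpha> * (b' $ n * b $ n))"
      using eq[OF m] by (intro sum.cong refl) (simp add: ac_simps)
    also have "\<dots> = a' $ m * \<alpha> * (b' \<bullet> b)"
      using b b' by (simp add: scalar_prod_lessThan sum_distrib_left)
    finally show ?thesis using s by (simp add: k_def field_simps)
  qed
  then have k: "a = k \<cdot>\<^sub>v a'" using a a' by (intro eq_vecI) auto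
  then have "k * k = 1" using a a' by simp
  then have "k \<in> {1, -1}" by (simp add: square_eq_1_iff)
  moreover from \<open>k * k = 1\<close> have "a' = k \<cdot>\<^sub>v a" using k by (simp add: smult_smult_assoc)
  ultimately show thesis using that by blast
qed

text \<open>The known factors are feasible with error zero, so any optimal solution also has error
  zero and reproduces the matrix exactly. Uniqueness of unit rank-one factors up to sign then
  applies.\<close>

lemma nkd_optimal_rank_one:
  assumes opt: "nkd_optimal M N (rearrange M N v) \<alpha> a' b'"
    and a: "a \<in> carrier_vec M" "a \<bullet> a = 1" and b: "b \<in> carrier_vec N" "b \<bullet> b = 1"
    and s: "s \<noteq> 0"
    and v: "\<And>p. p < M * N \<Longrightarrow> v $ p = s * (a $ (p div N) * b $ (p mod N))"
  shows "\<exists>r\<in>{1, - 1 :: real}. a' = r \<cdot>\<^sub>v a" and "\<exists>r\<in>{1, - 1 :: real}. b' = r \<cdot>\<^sub>v b"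
proof -
  let ?R = "rearrange M N v"
  have a': "a' \<in> carrier_vec M" "a' \<bullet> a' = 1" and b': "b' \<in> carrier_vec N" "b' \<bullet> b' = 1"
    using opt unfolding nkd_optimal_def nkd_feasible_def vnorm_eq_1_iff by auto
  have R: "?R $$ (m, n) = s * (a $ m * b $ n)" if "m < M" "n < N" for m n
    using that v[of "m * N + n"] block_index_less[of m M n N] by (simp add: rearrange_def)
  have "?R - s \<cdot>\<^sub>m outer a b = 0\<^sub>m M N"
    using a b R by (intro eq_matI) (auto simp: outer_def rearrange_def)
  then have "nkd_objective ?R s a b = 0"
    unfolding nkd_objective_def by (simp add: frobenius_norm_eq_0_iff)
  then have "nkd_objective ?R \<alpha> a' b' \<le> 0"
    using opt a b unfolding nkd_optimal_def nkd_feasible_def vnorm_eq_1_iff by metis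
  then have "frobenius_norm (?R - \<alpha> \<cdot>\<^sub>m outer a' b') = 0"
    unfolding nkd_objective_def by simp
  then have 0: "?R - \<alpha> \<cdot>\<^sub>m outer a' b' = 0\<^sub>m M N"
    using a' b' by (simp add: frobenius_norm_eq_0_iff outer_def)
  have eq: "s * (a $ m * b $ n) = \<alpha> * (a' $ m * b' $ n)" if "m < M" "n < N" for m n
  proof -
    have "(?R - \<alpha> \<cdot>\<^sub>m outer a' b') $$ (m, n) = 0" using 0 that by simp
    then show ?thesis using that a' b' R[OF that] by (simp add: outer_def)
  qed
  show "\<exists>r\<in>{1, - 1 :: real}. a' = r \<cdot>\<^sub>v a"
    using outer_eq_outer_unit[OF a b a' b'(1) s eq] by blast
  \<comment> \<open>The roles of the two factors are exchanged to treat the second one.\<close>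
  have "s * (b $ n * a $ m) = \<alpha> * (b' $ n * a' $ m)" if "n < N" "m < M" for n m
    using eq[OF that(2,1)] by (simp add: ac_simps)
  from outer_eq_outer_unit[OF b a b' a'(1) s this]
  show "\<exists>r\<in>{1, - 1 :: real}. b' = r \<cdot>\<^sub>v b" by blast
qed

section \<open>Gram-Schmidt on signed copies of an orthonormal family\<close>

text \<open>The index \<open>k\<close> is kept as an argument so that \<open>list_all2\<close> can
  follow a list of vectors by the list of their indices, where repetitions are visible.\<close>

definition signed_copy :: "('i \<Rightarrow> real vec) \<Rightarrow> real vec \<Rightarrow> 'i \<Rightarrow> bool" where
  "signed_copy w v k \<longleftrightarrow> (\<exists>r\<in>{1, -1}. v = r \<cdot>\<^sub>v w k)"

definition orthonormal_family :: "nat \<Rightarrow> 'i set \<Rightarrow> ('i \<Rightarrow> real vec) \<Rightarrow> bool" where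
  "orthonormal_family n K w \<longleftrightarrow> (\<forall>k\<in>K. w k \<in> carrier_vec n) \<and>
     (\<forall>j\<in>K. \<forall>k\<in>K. w j \<bullet> w k = (if j = k then 1 else 0))"

text \<open>All retained vectors are orthogonal to \<open>v\<close> except a copy with the same
  index, which occurs at most once and whose projection is \<open>v\<close> itself. The start
  \<open>u\<close> is general because the fold changes its accumulator.\<close>

lemma gs_fold_signed_copies:
  assumes w: "orthonormal_family n K w" and v: "signed_copy w v k" "k \<in> K"
    and qs: "list_all2 (signed_copy w) qs ks" and "distinct ks" "set ks \<subseteq> K"
    and u: "u \<in> carrier_vec n"
  shows "fold (\<lambda>q r. r - (q \<bullet> v) \<cdot>\<^sub>v q) qs u = (if k \<in> set ks then u - v else u)"
  using qs \<open>distinct ks\<close> \<open>set ks \<subseteq> K\<close> u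
proof (induction arbitrary: u rule: list_all2_induct)
  case (Cons q qs j ks)
  obtain r where r: "r \<in> {1, -1}" "v = r \<cdot>\<^sub>v w k" using v(1) unfolding signed_copy_def by blast
  obtain t where t: "t \<in> {1, -1}" "q = t \<cdot>\<^sub>v w j" using Cons.hyps(1) unfolding signed_copy_def by blast
  have wc: "w k \<in> carrier_vec n" "w j \<in> carrier_vec n" and
    jk: "w j \<bullet> w k = (if j = k then 1 else 0)"
    using w v(2) Cons.prems unfolding orthonormal_family_def by auto
  have qv: "q \<bullet> v = t * r * (if j = k then 1 else 0)" using wc r t jk by simp
  \<comment> \<open>The sign \<open>t\<close> of \<open>q\<close> enters the projection twice and
    cancels, so for \<open>j = k\<close> exactly \<open>v\<close> is subtracted.\<close>
  have step: "u - (q \<bullet> v) \<cdot>\<^sub>v q = (if j = k then u - v else u)"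
    unfolding qv using r t wc Cons.prems(3) by (intro eq_vecI) auto
  have "u - v \<in> carrier_vec n" using r wc Cons.prems(3) by simp
  then show ?case using Cons.IH Cons.prems by (auto simp: step)
qed simp

lemma signed_copy_unit:
  assumes "orthonormal_family n K w" "signed_copy w v k" "k \<in> K"
  shows "v \<in> carrier_vec n" "v \<bullet> v = 1"
  using assms unfolding signed_copy_def orthonormal_family_def by auto

text \<open>Invariant: the retained vectors are signed copies with distinct indices. A repeated
  index has residual zero and is dropped; a new one is its own residual, already of norm one, and is
  kept unchanged.\<close>

lemma gs_aux_signed_copies:
  assumes w: "orthonormal_family n K w"
    and "list_all2 (signed_copy w) qs ks" "distinct ks" "set ks \<subseteq> K"
    and "list_all2 (signed_copy w) vs js" "set js \<subseteq> K"
  obtains ls where "list_all2 (signed_copy w) (gs_aux qs vs) ls" "distinct ls" "set ls = set ks \<union> set js"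
proof -
  have "\<exists>ls. list_all2 (signed_copy w) (gs_aux qs vs) ls \<and> distinct ls \<and> set ls = set ks \<union> set js"
    using assms(5,2,3,4,6)
  proof (induction arbitrary: qs ks rule: list_all2_induct)
    case (Cons v vs j js)
    note v = signed_copy_unit[OF w Cons.hyps(1)]
    have vc: "v \<in> carrier_vec n" "v \<bullet> v = 1" using v Cons.prems by auto
    then have v0: "v \<noteq> 0\<^sub>v n" by auto
    have res: "gs_residual qs v = (if j \<in> set ks then 0\<^sub>v n else v)"
      unfolding gs_residual_def
      using gs_fold_signed_copies[OF w Cons.hyps(1) _ Cons.prems(1-3) vc(1)] Cons.prems vc by auto
    show ?case
    proof (cases "j \<in> set ks")
      case True
      then have "gs_aux qs (v # vs) = gs_aux qs vs" using res vc by simp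
      then show ?thesis using Cons.IH[OF Cons.prems(1-3)] Cons.prems(4) True by auto
    next
      case False
      then have "gs_aux qs (v # vs) = gs_aux (qs @ [v]) vs"
        using res vc v0 by (simp add: Let_def vnorm_def)
      moreover have "list_all2 (signed_copy w) (qs @ [v]) (ks @ [j])"
        using Cons.prems(1) Cons.hyps(1) by (simp add: list_all2_appendI)
      ultimately show ?thesis
        using Cons.IH[of "qs @ [v]" "ks @ [j]"] Cons.prems False by auto
    qed
  qed auto
  then show thesis using that by blast
qed

text \<open>The retained indices are distinct and exhaust all \<open>n\<close> columns, so listing
  them in order of retention is the required permutation.\<close>

lemma gram_schmidt_signed_columns:
  assumes V: "V \<in> carrier_mat n n" "V\<^sup>T * V = 1\<^sub>m n"
    and vs: "list_all2 (signed_copy (col V)) vs js" and js: "set js = {..<n}"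
  shows "same_cols_upto_perm_sign n (mat_of_cols n (gram_schmidt_columns vs)) V"
proof -
  have w: "orthonormal_family n {..<n} (col V)"
    using V(1) orthonormal_matrix_index(1)[OF V] unfolding orthonormal_family_def
    by (auto simp: scalar_prod_def atLeast0LessThan)
  let ?gs = "gram_schmidt_columns vs"
  obtain ls where ls: "list_all2 (signed_copy (col V)) ?gs ls" "distinct ls" "set ls = {..<n}"
    using gs_aux_signed_copies[OF w list_all2_Nil[THEN iffD2, OF refl] _ _ vs] js
    unfolding gram_schmidt_columns_def by auto
  have len: "length ls = n" "length ?gs = n"
    using ls distinct_card[of ls] list_all2_lengthD[OF ls(1)] by auto
  \<comment> \<open>\<open>permutes\<close> demands the identity outside
    \<open>{..<n}\<close>.\<close>
  define \<pi> where "\<pi> i = (if i < n then ls ! i else i)" for i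
  have "bij_betw ((!) ls) {..<n} {..<n}"
    by (rule bij_betw_nth[OF ls(2)]) (simp_all add: len ls(3))
  then have "bij_betw \<pi> {..<n} {..<n}"
    by (rule bij_betw_cong[THEN iffD1, rotated]) (simp add: \<pi>_def)
  then have perm: "\<pi> permutes {..<n}" by (rule bij_imp_permutes) (simp add: \<pi>_def)
  have "\<forall>i<n. \<exists>r. r \<in> {1, -1} \<and> ?gs ! i = r \<cdot>\<^sub>v col V (\<pi> i)"
    using list_all2_nthD[OF ls(1)] len unfolding signed_copy_def \<pi>_def by fastforce
  then obtain s where s: "\<And>i. i < n \<Longrightarrow> s i \<in> {1, -1} \<and> ?gs ! i = s i \<cdot>\<^sub>v col V (\<pi> i)"
    by metis
  have "col (mat_of_cols n ?gs) i = s i \<cdot>\<^sub>v col V (\<pi> i)" if "i < n" for i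
  proof -
    have "?gs ! i \<in> carrier_vec n" using s[OF that] V(1) by (simp add: carrier_vecI)
    then show ?thesis using s[OF that] that len by (simp add: col_mat_of_cols)
  qed
  then show ?thesis
    unfolding same_cols_upto_perm_sign_def using perm s len mat_of_cols_carrier(1)[of n ?gs] by metis
qed

section \<open>Recovery of the eigenvectors of both factor graphs\<close>

theorem corollary1:
  fixes M N :: nat
    and AC AG VC VG :: "real mat"
    and lC lG :: "nat \<Rightarrow> real"
    and h :: "nat \<Rightarrow> nat \<Rightarrow> real"
    and TG TC :: enat
    and P :: "'w measure"
    and x y :: "'w \<Rightarrow> real vec"
    and VC_hat VG_hat :: "real mat"
  assumes "M \<ge> 1" and "N \<ge> 1"
    and "AC \<in> carrier_mat M M" and "AC\<^sup>T = AC"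
    and "AG \<in> carrier_mat N N" and "AG\<^sup>T = AG"
    and "VC \<in> carrier_mat M M" and "VC\<^sup>T * VC = 1\<^sub>m M"
    and "VG \<in> carrier_mat N N" and "VG\<^sup>T * VG = 1\<^sub>m N"
    and "AC = VC * mat_diag M lC * VC\<^sup>T"
    and "AG = VG * mat_diag N lG * VG\<^sup>T"
    and "antimono_on {..<M} lC" and "antimono_on {..<N} lG"
    and "\<And>j i. j < M \<Longrightarrow> i < N \<Longrightarrow> freq_response_convergent h TG TC (lC j) (lG i)"
    and "inj_on (\<lambda>(j, i). \<bar>freq_response h TG TC (lC j) (lG i)\<bar>) ({..<M} \<times> {..<N})"
    and "prob_space P"
    and "random_vector P (M * N) x"
    and "square_integrable P (M * N) x"
    and "expectation_vec P (M * N) x = 0\<^sub>v (M * N)"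
    and "expectation_mat P (M * N) (\<lambda>\<omega>. outer (x \<omega>) (x \<omega>)) = 1\<^sub>m (M * N)"
    and "\<And>\<omega>. \<omega> \<in> space P \<Longrightarrow> y \<omega> = graph_filter h TG TC AC AG *\<^sub>v x \<omega>"
    and "eigenvector_recovery M N (expectation_mat P (M * N) (\<lambda>\<omega>. outer (y \<omega>) (y \<omega>))) VC_hat VG_hat"
  shows "same_cols_upto_perm_sign M VC_hat VC \<and> same_cols_upto_perm_sign N VG_hat VG"
proof -
  note VC = \<open>VC \<in> carrier_mat M M\<close> \<open>VC\<^sup>T * VC = 1\<^sub>m M\<close>
  note VG = \<open>VG \<in> carrier_mat N N\<close> \<open>VG\<^sup>T * VG = 1\<^sub>m N\<close>
  let ?S = "{..<M} \<times> {..<N}"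
  \<comment> \<open>\<open>U (a, b)\<close> lists the entries of the Kronecker product of column
    \<open>a\<close> of \<open>VC\<close> and column \<open>b\<close> of \<open>VG\<close>.\<close>
  define U where "U t p = VC $$ (p div N, fst t) * VG $$ (p mod N, snd t)" for t p
  define f where "f t = freq_response h TG TC (lC (fst t)) (lG (snd t))" for t
  define H where "H = graph_filter h TG TC AC AG"
  define C where "C = expectation_mat P (M * N) (\<lambda>\<omega>. outer (y \<omega>) (y \<omega>))"
  have orth: "(\<Sum>p<M * N. U s p * U t p) = (if s = t then 1 else 0)" if "s \<in> ?S" "t \<in> ?S" for s t
  proof -
    have "(\<Sum>p<M * N. U s p * U t p) = (\<Sum>(m, n)\<in>?S.
        VC $$ (m, fst s) * VC $$ (m, fst t) * (VG $$ (n, snd s) * VG $$ (n, snd t)))"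
      unfolding sum_div_mod_Times[symmetric] U_def by (simp add: ac_simps)
    also have "\<dots> = (\<Sum>m<M. VC $$ (m, fst s) * VC $$ (m, fst t)) * (\<Sum>n<N. VG $$ (n, snd s) * VG $$ (n, snd t))"
      by (simp add: sum_product sum.cartesian_product)
    also have "\<dots> = (if s = t then 1 else 0)"
      using that orthonormal_matrix_index(1)[OF VC] orthonormal_matrix_index(1)[OF VG]
      by (auto simp: prod_eq_iff)
    finally show ?thesis .
  qed
  have compl: "(\<Sum>t\<in>?S. U t p * U t q) = (if p = q then 1 else 0)" if "p < M * N" "q < M * N" for p q
  proof -
    have less: "p div N < M" "q div N < M" "p mod N < N" "q mod N < N"
      using that \<open>N \<ge> 1\<close> by (auto simp: less_mult_imp_div_less)
    have "(\<Sum>t\<in>?S. U t p * U t q) = (\<Sum>a<M. VC $$ (p div N, a) * VC $$ (q div N, a)) *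
        (\<Sum>b<N. VG $$ (p mod N, b) * VG $$ (q mod N, b))"
      unfolding sum_product sum.cartesian_product by (intro sum.cong refl) (auto simp: U_def)
    also have "\<dots> = (if p div N = q div N \<and> p mod N = q mod N then 1 else 0)"
      using less by (simp add: orthonormal_matrix_index(2)[OF VC] orthonormal_matrix_index(2)[OF VG])
    also have "p div N = q div N \<and> p mod N = q mod N \<longleftrightarrow> p = q"
      by (metis div_mult_mod_eq)
    finally show ?thesis .
  qed
  have H: "H \<in> carrier_mat (M * N) (M * N)"
    using assms(3,5) unfolding H_def by (simp add: graph_filter_def mat_sum_upto_def Let_def)
  have Hspec: "H $$ (p, q) = (\<Sum>t\<in>?S. f t * U t p * U t q)" if "p < M * N" "q < M * N" for p q
    unfolding H_def
    by (subst graph_filter_index[OF VC VG assms(11,12) _ that])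
      (use assms(15) in \<open>auto simp: f_def U_def intro!: sum.cong\<close>)
  have C: "C = H * H\<^sup>T"
    unfolding C_def H_def
    by (rule covariance_of_white_input[OF assms(18,19,21) _ assms(22)]) (use H in \<open>simp add: H_def\<close>)
  then have Cc: "C \<in> carrier_mat (M * N) (M * N)" using H by simp
  have Cspec: "C $$ (p, q) = (\<Sum>t\<in>?S. (f t)\<^sup>2 * U t p * U t q)" if "p < M * N" "q < M * N" for p q
    unfolding C by (rule spectral_square[OF _ H Hspec orth that]) auto
  \<comment> \<open>Squares of reals agree exactly when the absolute values do, so the eigenvalues
    of \<open>C\<close> are simple.\<close>
  have inj: "inj_on (\<lambda>t. (f t)\<^sup>2) ?S"
    using assms(16) unfolding inj_on_def f_def by (auto simp: power2_eq_iff abs_eq_iff)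
  obtain vs cs gs where
    vs: "length vs = M * N"
      "\<And>i. i < M * N \<Longrightarrow> vs ! i \<in> carrier_vec (M * N) \<and> (\<exists>e. eigenvector C (vs ! i) e)"
      "\<And>i j. i < M * N \<Longrightarrow> j < M * N \<Longrightarrow> vs ! i \<bullet> vs ! j = (if i = j then 1 else 0)"
    and len: "length cs = M * N" "length gs = M * N"
    and nkd: "\<And>i. i < M * N \<Longrightarrow> \<exists>\<alpha>. nkd_optimal M N (rearrange M N (vs ! i)) \<alpha> (cs ! i) (gs ! i)"
    and out: "VC_hat = mat_of_cols M (gram_schmidt_columns cs)" "VG_hat = mat_of_cols N (gram_schmidt_columns gs)"
    using assms(23) unfolding C_def[symmetric] eigenvector_recovery_def orthonormal_eigenbasis_def by blast
  have "\<exists>t s. t \<in> ?S \<and> s \<in> {1, -1} \<and> (\<forall>p<M * N. vs ! i $ p = s * U t p)" if i: "i < M * N" for i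
  proof -
    obtain e where e: "eigenvector C (vs ! i) e" using vs(2)[OF i] by auto
    have unit: "vs ! i \<bullet> vs ! i = 1" using vs(3)[OF i i] by simp
    obtain t s where "t \<in> ?S" "s \<in> {1, -1}" "\<And>p. p < M * N \<Longrightarrow> vs ! i $ p = s * U t p"
      by (rule unit_eigenvector_simple_spectrum[OF _ Cc Cspec inj orth compl e unit]) auto
    then show ?thesis by blast
  qed
  \<comment> \<open>The pair \<open>t i\<close> names the Kronecker basis vector that the
    \<open>i\<close>-th computed eigenvector copies, and \<open>s i\<close> is the sign.\<close>
  then obtain t s where t: "\<And>i. i < M * N \<Longrightarrow> t i \<in> ?S"
    and s: "\<And>i. i < M * N \<Longrightarrow> s i \<in> {1, -1}"
    and vU: "\<And>i p. i < M * N \<Longrightarrow> p < M * N \<Longrightarrow> vs ! i $ p = s i * U (t i) p"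
    by metis
  \<comment> \<open>Two eigenvectors copying the same basis vector would have inner product
    \<open>s i * s j\<close>, which is not zero.\<close>
  have "inj_on t {..<M * N}"
  proof (rule inj_onI, rule ccontr)
    fix i j assume ij: "i \<in> {..<M * N}" "j \<in> {..<M * N}" "t i = t j" "i \<noteq> j"
    then have "0 = (\<Sum>p<M * N. vs ! i $ p * vs ! j $ p)"
      using vs(2,3)[of i] vs(2)[of j] by (metis lessThan_iff scalar_prod_lessThan)
    also have "\<dots> = (\<Sum>p<M * N. s i * s j * (U (t i) p * U (t j) p))"
      using ij by (intro sum.cong refl) (simp add: vU)
    also have "\<dots> = s i * s j"
      using ij t[of i] by (simp add: sum_distrib_left[symmetric] orth)
    finally show False using ij s[of i] s[of j] by auto
  qed
  \<comment> \<open>An injection between finite sets of equal size is onto, so every pair of columns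
    occurs among the eigenvectors.\<close>
  then have "card (t ` {..<M * N}) = card ?S" by (simp add: card_image)
  then have img: "t ` {..<M * N} = ?S"
    using t by (intro card_subset_eq image_subsetI) auto
  have R: "signed_copy (col VC) (cs ! i) (fst (t i)) \<and> signed_copy (col VG) (gs ! i) (snd (t i))"
    if i: "i < M * N" for i
  proof -
    obtain a b where ab: "t i = (a, b)" "a < M" "b < N" using t[OF i] by auto
    obtain \<alpha> where opt: "nkd_optimal M N (rearrange M N (vs ! i)) \<alpha> (cs ! i) (gs ! i)" using nkd[OF i] by auto
    have "col VC a \<bullet> col VC a = 1" "col VG b \<bullet> col VG b = 1"
      using orthonormal_matrix_index(1)[OF VC ab(2,2)] orthonormal_matrix_index(1)[OF VG ab(3,3)] VC VG ab
      by (auto simp: scalar_prod_def atLeast0LessThan)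
    moreover have "vs ! i $ p = s i * (col VC a $ (p div N) * col VG b $ (p mod N))" if "p < M * N" for p
      using vU[OF i that] ab VC VG that \<open>N \<ge> 1\<close> by (simp add: U_def less_mult_imp_div_less)
    moreover have "s i \<noteq> 0" using s[OF i] by auto
    ultimately show ?thesis
      using nkd_optimal_rank_one[OF opt, of "col VC a" "col VG b" "s i"] ab VC VG
      unfolding signed_copy_def by auto
  qed
  have "list_all2 (signed_copy (col VC)) cs (map (fst \<circ> t) [0..<M * N])"
    "list_all2 (signed_copy (col VG)) gs (map (snd \<circ> t) [0..<M * N])"
    using R len by (auto simp: list_all2_conv_all_nth)
  \<comment> \<open>Each projection of the index rectangle is onto because the other side is
    nonempty; hence no column is missed.\<close>
  moreover have "set (map (fst \<circ> t) [0..<M * N]) = {..<M}" "set (map (snd \<circ> t) [0..<M * N]) = {..<N}"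
    using \<open>M \<ge> 1\<close> \<open>N \<ge> 1\<close> unfolding set_map set_upt image_comp[symmetric] atLeast0LessThan img
    by (auto simp: fst_image_times snd_image_times lessThan_empty_iff)
  ultimately show ?thesis
    unfolding out using gram_schmidt_signed_columns[OF VC] gram_schmidt_signed_columns[OF VG] by blast
qed

end
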